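(* Let $d\ge 2$, let $p_1,\dots,p_d$ be pairwise distinct primes, let $k_1,\dots,k_d$ be positive integers, and put $k=p_1^{k_1}\cdots p_d^{k_d}$. For each $1\le i\le d$ let $M_i$ be a difference matrix in $D(p_i^{k_i},p_i^{k_i},\mathbb{Z}_{p_i}^{k_i})$, and let $(a^i(n))_{n\ge0}=(a^i_1(n),\dots,a^i_{k_i}(n))_{n\ge 0}$ be the Rudin--Shapiro sequence associated to $M_i$. Define $\hat a(n)=(a^1(n),\dots,a^d(n))$ (a sequence over an alphabet of size $k$), and for $0\le i<j$ let $\delta(i,j)=0$ if $\hat a(i)=\hat a(j)$ and $\delta(i,j)=1$ otherwise. Then, for $0\le r_1<r_2$, as $N\to\infty$, $$\sum_{n<N}\delta(n+r_1,n+r_2)=N\left(1-\frac{1}{k}\right)+O_k\left(\left((r_2-r_1)\log\frac{N^{1/d}}{r_2-r_1}+r_2\right)N^{\frac{d-1}{d}}\right),$$ where the implied constant depends only on $k$ (and not on $r_1,r_2$).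
   Context: $\mathbb{Z}_p=\mathbb{Z}/p\mathbb{Z}$ and $\mathbb{Z}_p^m$ is the $m$-fold product group. For a finite abelian group $G$, a difference matrix $D=(d_{ij})$ of size $r\times c$ with entries in $G$ is a matrix such that for all $i\neq j$ in $\{1,\dots,c\}$, the multiset $\{d_{li}-d_{lj}:1\le l\le r\}$ contains every element of $G$ equally often; $D(r,c,G)$ denotes the set of such matrices. Given a prime $p$, $m\ge1$ and $M=(m_{ij})_{0\le i,j<p^m}\in D(p^m,p^m,\mathbb{Z}_p^m)$, define $g:\mathbb{Z}\times\mathbb{Z}\to\mathbb{Z}_p^m$ by $g(j,n)=m_{n \bmod p^m,\, j \bmod p^m}$. The Rudin--Shapiro sequence associated to $M$ is the sequence $(a(n))_{n\ge0}$ with values in $\mathbb{Z}_p^m$, with $a(0)$ fixed arbitrarily, defined by $a(p^mn+j)=a(n)+g(j,n)$ for $0\le j\le p^m-1$, $n\ge 0$, $(j,n)\neq(0,0)$. *)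

theory Defs
  imports Complex_Main "HOL-Computational_Algebra.Primes" "HOL-Algebra.Product_Groups"
begin

text \<open>The group \<open>\<int>\<^sub>p\<^sup>m\<close>. The groups are written multiplicatively: \<open>\<otimes>\<close> is componentwise addition
  modulo \<open>p\<close> and \<open>inv\<close> is componentwise negation modulo \<open>p\<close>.\<close>

definition Zp_power :: "nat \<Rightarrow> nat \<Rightarrow> (nat \<Rightarrow> int) monoid" where
  "Zp_power p m = product_group {1..m} (\<lambda>_. integer_mod_group p)"

text \<open>Rows and columns are numbered from \<open>0\<close>; values of \<open>D\<close> outside the index range are
  irrelevant. The multiplicity of \<open>x\<close> among the differences of columns \<open>i\<close> and \<open>j\<close> is
  required to be the same number for all \<open>x\<close>.\<close>

definition difference_matrices ::
    "nat \<Rightarrow> nat \<Rightarrow> ('a, 'b) monoid_scheme \<Rightarrow> (nat \<Rightarrow> nat \<Rightarrow> 'a) set" where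
  "difference_matrices r c G =
    {D. (\<forall>l<r. \<forall>i<c. D l i \<in> carrier G) \<and>
        (\<forall>i<c. \<forall>j<c. i \<noteq> j \<longrightarrow>
          (\<exists>\<mu>. \<forall>x\<in>carrier G. card {l. l < r \<and> D l i \<otimes>\<^bsub>G\<^esub> inv\<^bsub>G\<^esub> (D l j) = x} = \<mu>))}"

definition rs_g :: "nat \<Rightarrow> nat \<Rightarrow> (nat \<Rightarrow> nat \<Rightarrow> nat \<Rightarrow> int) \<Rightarrow> nat \<Rightarrow> nat \<Rightarrow> (nat \<Rightarrow> int)" where
  "rs_g p m M j n = M (n mod p ^ m) (j mod p ^ m)"

text \<open>The initial value \<open>a 0\<close> is an arbitrary group element, so this is a predicate.\<close>

definition rudin_shapiro ::
    "nat \<Rightarrow> nat \<Rightarrow> (nat \<Rightarrow> nat \<Rightarrow> nat \<Rightarrow> int) \<Rightarrow> (nat \<Rightarrow> nat \<Rightarrow> int) \<Rightarrow> bool" where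
  "rudin_shapiro p m M a \<longleftrightarrow>
    (\<forall>n. a n \<in> carrier (Zp_power p m)) \<and>
    (\<forall>n j. j < p ^ m \<and> (j, n) \<noteq> (0, 0) \<longrightarrow>
       a (p ^ m * n + j) = a n \<otimes>\<^bsub>Zp_power p m\<^esub> rs_g p m M j n)"

definition combined_seq :: "nat \<Rightarrow> (nat \<Rightarrow> nat \<Rightarrow> 'a) \<Rightarrow> nat \<Rightarrow> (nat \<Rightarrow> 'a)" where
  "combined_seq d a n = (\<lambda>i\<in>{1..d}. a i n)"

definition discrepancy :: "(nat \<Rightarrow> 'a) \<Rightarrow> nat \<Rightarrow> nat \<Rightarrow> real" where
  "discrepancy s i j = (if s i = s j then 0 else 1)"

end

theory Submission
  imports Defs "HOL-Number_Theory.Cong"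
begin

text \<open>
  Put \<open>q\<^sub>i = p\<^sub>i ^ k\<^sub>i\<close> and \<open>r = r\<^sub>2 - r\<^sub>1\<close>, and let \<open>t\<close> be the topmost digit in which \<open>v\<close> and
  \<open>v + r\<close> differ in base \<open>q\<^sub>i\<close>. Then \<open>a\<^sup>i (v + r) - a\<^sup>i v\<close> depends only on the digits
  \<open>0, \<dots>, t + 1\<close> of \<open>v\<close>, and on the digit \<open>t + 1\<close> through the difference of two columns of the matrix
  in the row given by that digit. Since every group element occurs exactly once in such a
  difference, exactly one out of \<open>q\<^sub>i\<close> residues of level \<open>t\<close> modulo \<open>q\<^sub>i ^ (t + 2)\<close> is a
  coincidence, and there are at most \<open>q\<^sub>i\<^sup>2 r\<close> residues of that level. For a fixed tuple of levels the
  Chinese remainder theorem combines the \<open>d\<close> bases with an error of \<open>O(r ^ d)\<close>. Levels are cut off at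
  \<open>q\<^sub>i ^ t \<approx> X = N powr (1 / d)\<close>, which leaves \<open>O(1 + L)\<close> of them in each base, where
  \<open>L = ln (X / r)\<close>, and loses \<open>O(r N / X)\<close> integers. The total error \<open>(r (1 + L)) ^ d\<close>
  is at most \<open>r (1 + L) X ^ (d - 1)\<close> because \<open>1 + L \<le> exp L = X / r\<close>.
\<close>

section \<open>Levels of an integer\<close>


text \<open>Says that adding \<open>r\<close> leaves all base \<open>q\<close> digits of
  \<open>v\<close> from position \<open>s\<close> upward unchanged.\<close>

definition same_block :: "nat \<Rightarrow> nat \<Rightarrow> nat \<Rightarrow> nat \<Rightarrow> bool" where
  "same_block q r s v \<longleftrightarrow> (v + r) div q ^ s = v div q ^ s"

text \<open>In base \<open>q\<close>, digit \<open>t\<close> is the topmost digit in which \<open>v\<close> and \<open>v + r\<close> differ.\<close>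
definition at_level :: "nat \<Rightarrow> nat \<Rightarrow> nat \<Rightarrow> nat \<Rightarrow> bool" where
  "at_level q r t v \<longleftrightarrow> \<not> same_block q r t v \<and> same_block q r (Suc t) v"

lemma add_div_eq_div_iff:
  fixes m :: nat
  assumes "m > 0"
  shows "(v + r) div m = v div m \<longleftrightarrow> v mod m + r < m"
proof -
  have "v + r = (v mod m + r) + m * (v div m)" by simp
  then have "(v + r) div m = (v mod m + r) div m + v div m"
    using assms by (metis add.commute div_mult_self2 less_not_refl)
  then show ?thesis using assms by (auto simp: div_eq_0_iff)
qed

lemma same_block_iff: "q > 0 \<Longrightarrow> same_block q r s v \<longleftrightarrow> v mod q ^ s + r < q ^ s"
  unfolding same_block_def by (rule add_div_eq_div_iff) simp

lemma same_block_mono: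
  assumes "same_block q r s v" "s \<le> s'"
  shows "same_block q r s' v"
proof -
  have "x div q ^ s' = x div q ^ s div q ^ (s' - s)" for x
    using assms(2) by (metis div_mult2_eq le_add_diff_inverse power_add)
  with assms(1) show ?thesis by (simp add: same_block_def)
qed

lemma not_same_block_0: "r > 0 \<Longrightarrow> \<not> same_block q r 0 v"
  by (simp add: same_block_def)

lemma at_level_unique:
  assumes "at_level q r s v" "at_level q r t v"
  shows "s = t"
  using assms unfolding at_level_def
  by (metis Suc_leI linorder_neqE_nat same_block_mono)

lemma ex_at_level:
  assumes "r > 0" "same_block q r T v"
  shows "\<exists>t<T. at_level q r t v"
  using assms(2)
proof (induction T)
  case 0
  then show ?case using not_same_block_0[OF assms(1)] by simp
next
  case (Suc T)
  then show ?case unfolding at_level_def by (cases "same_block q r T v") (auto intro: less_SucI)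
qed

text \<open>Levels are periodic: the two \<open>same_block\<close> conditions are decided by the
  residues modulo \<open>q ^ t\<close> and \<open>q ^ Suc t\<close>, and both moduli divide
  \<open>q ^ s\<close>.\<close>

lemma at_level_mod:
  assumes "q > 0" "s > t"
  shows "at_level q r t (v mod q ^ s) \<longleftrightarrow> at_level q r t v"
proof -
  have "q ^ t dvd q ^ s" "q ^ Suc t dvd q ^ s"
    using assms by (auto intro!: le_imp_power_dvd simp del: power_Suc)
  then show ?thesis
    using assms by (simp add: at_level_def same_block_iff mod_mod_cancel del: power_Suc)
qed

lemma at_level_imp_less:
  assumes "q > 0" "at_level q r t v"
  shows "r < q ^ Suc t"
  using assms unfolding at_level_def same_block_iff[OF assms(1)] by linarith

lemma div_mod_power_Suc: "(v::nat) div q mod q ^ s = v mod q ^ Suc s div q"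
proof (cases "q = 0")
  case False
  then show ?thesis by (simp add: mod_mult2_eq)
qed simp

lemma card_upper_residues: "card {w. w < m \<and> m \<le> w + r} \<le> (r::nat)"
proof -
  have "{w. w < m \<and> m \<le> w + r} \<subseteq> {m - r..<m}" by auto
  then have "card {w. w < m \<and> m \<le> w + r} \<le> card {m - r..<m}" by (intro card_mono) auto
  then show ?thesis by simp
qed

text \<open>The lowest \<open>t\<close> digits must form a number within \<open>r\<close> of
  \<open>q ^ t\<close>, which leaves at most \<open>r\<close> values, and digit \<open>t\<close>
  takes at most \<open>q\<close>. For \<open>r > q ^ t\<close> the trivial bound
  \<open>q ^ Suc t\<close> suffices.\<close>

lemma card_at_level_le:
  assumes "q > 0"
  shows "card {u. u < q ^ Suc t \<and> at_level q r t u} \<le> q * r"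
proof (cases "r \<le> q ^ t")
  case True
  define S where "S = {w. w < q ^ t \<and> q ^ t \<le> w + r}"
  have fS: "finite S" unfolding S_def by auto
  let ?f = "\<lambda>u. (u div q ^ t, u mod q ^ t)"
  have "inj_on ?f {u. u < q ^ Suc t \<and> at_level q r t u}"
    by (rule inj_onI) (metis div_mult_mod_eq prod.inject)
  moreover have "?f ` {u. u < q ^ Suc t \<and> at_level q r t u} \<subseteq> {..<q} \<times> S"
    using assms by (auto simp: S_def at_level_def same_block_iff less_mult_imp_div_less)
  ultimately have "card {u. u < q ^ Suc t \<and> at_level q r t u} \<le> card ({..<q} \<times> S)"
    using fS by (intro card_inj_on_le) auto
  also have "\<dots> \<le> q * r"
    using card_upper_residues[of "q ^ t" r] by (simp add: S_def card_cartesian_product)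
  finally show ?thesis .
next
  case False
  have "card {u. u < q ^ Suc t \<and> at_level q r t u} \<le> card {..<q ^ Suc t}"
    by (intro card_mono) auto
  also have "\<dots> \<le> q * r" using False by simp
  finally show ?thesis .
qed

section \<open>Coincidences in one base\<close>

text \<open>The common setting for one base. \<open>D_bij\<close> is the difference property with
  multiplicity one, which is forced when the number of rows equals the order of the group.
  \<open>a_rec\<close> is the defining recurrence in terms of the whole argument.\<close>

locale rs_system = comm_group G for G (structure) +
  fixes q :: nat and D :: "nat \<Rightarrow> nat \<Rightarrow> 'a" and a :: "nat \<Rightarrow> 'a"
  assumes q_ge_2: "q \<ge> 2"
    and D_closed [simp]: "\<And>l i. l < q \<Longrightarrow> i < q \<Longrightarrow> D l i \<in> carrier G"
    and D_bij: "\<And>i j. i < q \<Longrightarrow> j < q \<Longrightarrow> i \<noteq> j \<Longrightarrow>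
      bij_betw (\<lambda>l. D l i \<otimes> inv (D l j)) {..<q} (carrier G)"
    and a_closed [simp]: "\<And>n. a n \<in> carrier G"
    and a_rec: "\<And>n. n \<noteq> 0 \<Longrightarrow> a n = a (n div q) \<otimes> D (n div q mod q) (n mod q)"
begin

lemma q_pos [simp]: "q > 0" and q_nz [simp]: "q \<noteq> 0"
  using q_ge_2 by auto

text \<open>As long as no quotient vanishes, this is the product of the matrix entries collected by
  unfolding the recurrence \<open>s\<close> times.\<close>

definition low_part :: "nat \<Rightarrow> nat \<Rightarrow> 'a" where
  "low_part s v = a v \<otimes> inv (a (v div q ^ s))"

lemma low_part_closed [simp]: "low_part s v \<in> carrier G"
  by (simp add: low_part_def)

lemma a_eq_low_part: "a v = low_part s v \<otimes> a (v div q ^ s)"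
  by (simp add: low_part_def m_assoc)

lemma low_part_Suc:
  assumes "v \<noteq> 0"
  shows "low_part (Suc s) v = low_part s (v div q) \<otimes> D (v div q mod q) (v mod q)"
  unfolding low_part_def a_rec[OF assms]
  by (simp add: div_mult2_eq m_ac)

text \<open>Each unfolding reads two adjacent digits, so \<open>s\<close> of them read the digits
  \<open>0\<close> to \<open>s\<close>; hence the modulus \<open>q ^ Suc s\<close>. The lower bounds
  keep every argument of the recurrence nonzero.\<close>

lemma low_part_cong:
  assumes "v mod q ^ Suc s = v' mod q ^ Suc s" "q ^ s \<le> v" "q ^ s \<le> v'"
  shows "low_part s v = low_part s v'"
  using assms
proof (induction s arbitrary: v v')
  case 0
  then show ?case by (simp add: low_part_def)
next
  case (Suc s)
  have nz: "v \<noteq> 0" "v' \<noteq> 0" using Suc.prems(2,3) zero_less_power[OF q_pos, of "Suc s"] by linarith+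
  have 1: "v div q mod q ^ Suc s = v' div q mod q ^ Suc s"
    unfolding div_mod_power_Suc using Suc.prems(1) by simp
  have ge: "q ^ s \<le> v div q" "q ^ s \<le> v' div q"
    using Suc.prems(2,3) by (simp_all add: less_eq_div_iff_mult_less_eq mult.commute)
  have "v div q mod q = v' div q mod q"
    using arg_cong[OF 1, of "\<lambda>x. x mod q"] by (simp add: mod_mod_cancel)
  moreover have "v mod q = v' mod q"
    using arg_cong[OF Suc.prems(1), of "\<lambda>x. x mod q"] by (simp add: mod_mod_cancel)
  ultimately show ?case
    using Suc.IH[OF 1 ge] nz by (simp add: low_part_Suc)
qed

lemma a_eq_iff_low_part:
  assumes "same_block q r s v"
  shows "a (v + r) = a v \<longleftrightarrow> low_part s (v + r) = low_part s v"
  using assms a_eq_low_part[of "v + r" s] a_eq_low_part[of v s]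
  by (simp add: same_block_def)

text \<open>The part of the sequence value above digit \<open>s\<close> is common to
  \<open>v\<close> and \<open>v + r\<close> and cancels; the two low parts depend only on the
  residue modulo \<open>q ^ Suc s\<close>.\<close>

lemma a_eq_residue:
  assumes "same_block q r s v" "same_block q r s v'" "v mod q ^ Suc s = v' mod q ^ Suc s"
    and "q ^ s \<le> v" "q ^ s \<le> v'"
  shows "a (v + r) = a v \<longleftrightarrow> a (v' + r) = a v'"
proof -
  have "low_part s v = low_part s v'" by (rule low_part_cong) (use assms in auto)
  moreover have "low_part s (v + r) = low_part s (v' + r)"
    by (rule low_part_cong) (use assms(3-5) in \<open>auto intro: mod_add_cong simp del: power_Suc\<close>)
  ultimately show ?thesis using assms by (simp add: a_eq_iff_low_part)
qed

text \<open>Two numbers whose topmost differing digit is digit \<open>t\<close>: the common digit \<open>e\<close> just above it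
  enters the difference of the sequence values only through the row \<open>e\<close> of \<open>D\<close>.\<close>
lemma ex1_digit:
  assumes "u < q ^ Suc t" "at_level q r t u"
  shows "\<exists>!e. e < q \<and> a (u + q ^ Suc t * e + q ^ Suc (Suc t) + r) = a (u + q ^ Suc t * e + q ^ Suc (Suc t))"
proof -
  define v where "v e = u + q ^ Suc t * e + q ^ Suc (Suc t)" for e
  \<comment> \<open>\<open>c\<close> and \<open>c'\<close> are digit \<open>t\<close> of
    \<open>u\<close> and of \<open>u + r\<close>. They are single digits because
    \<open>u + r < q ^ Suc t\<close>, and distinct because the level is \<open>t\<close>.\<close>
  define c where "c = u div q ^ t"
  define c' where "c' = (u + r) div q ^ t"
  have ur: "u + r < q ^ Suc t"
    using assms by (simp add: at_level_def same_block_iff del: power_Suc)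
  have cc: "c < q" "c' < q" "c' \<noteq> c"
    using assms ur unfolding c_def c'_def at_level_def same_block_def
    by (auto simp: less_mult_imp_div_less)
  have v_alt: "v e = u + q ^ t * (q * (e + q))" for e
    by (simp add: v_def algebra_simps)
  have vr_alt: "v e + r = (u + r) + q ^ t * (q * (e + q))" for e
    by (simp add: v_alt)
  have d: "v e div q ^ t = c + q * (e + q)" "(v e + r) div q ^ t = c' + q * (e + q)" for e
    unfolding vr_alt unfolding v_alt c_def c'_def by (simp_all add: add.commute)
  have ge: "q ^ t \<le> v e" for e
  proof -
    have "q ^ t \<le> q ^ Suc (Suc t)" by (rule power_increasing) (use q_ge_2 in auto)
    then show ?thesis by (simp add: v_def del: power_Suc)
  qed
  \<comment> \<open>The summand \<open>q ^ Suc (Suc t)\<close> in \<open>v e\<close> turns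
    \<open>e\<close> into \<open>e + q\<close>: the recurrence is applied to nonzero arguments even
    for \<open>e = 0\<close>, while the row is still \<open>(e + q) mod q = e\<close>.\<close>
  have a_hi: "a (v e div q ^ t) = a (e + q) \<otimes> D e c"
    "a ((v e + r) div q ^ t) = a (e + q) \<otimes> D e c'" if "e < q" for e
    unfolding d using that cc by (simp_all add: a_rec)
  define x where "x = low_part t (v 0)"
  define y where "y = low_part t (v 0 + r)"
  have xy: "x \<in> carrier G" "y \<in> carrier G" by (simp_all add: x_def y_def)
  have vm: "v e = u + q ^ Suc t * (e + q)" for e by (simp add: v_def algebra_simps)
  have "v e mod q ^ Suc t = v 0 mod q ^ Suc t" for e
    unfolding vm mod_mult_self2 ..
  moreover have "(v e + r) mod q ^ Suc t = (v 0 + r) mod q ^ Suc t" for e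
    using calculation mod_add_cong by blast
  ultimately have lp: "low_part t (v e) = x" "low_part t (v e + r) = y" for e
    unfolding x_def y_def by (blast intro: low_part_cong ge trans_le_add1)+
  \<comment> \<open>After \<open>a (e + q)\<close> is cancelled, the digit \<open>e\<close> survives
    only on the left, in a difference of the columns \<open>c'\<close> and \<open>c\<close>; the
    right side is a fixed group element, so \<open>D_bij\<close> singles out one row.\<close>
  have key: "a (v e + r) = a (v e) \<longleftrightarrow> D e c' \<otimes> inv (D e c) = x \<otimes> inv y" if "e < q" for e
  proof -
    have "a (v e + r) = a (v e) \<longleftrightarrow> y \<otimes> (a (e + q) \<otimes> D e c') = x \<otimes> (a (e + q) \<otimes> D e c)"
      using a_eq_low_part[of "v e" t] a_eq_low_part[of "v e + r" t] lp a_hi[OF that] by simp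
    also have "\<dots> \<longleftrightarrow> a (e + q) \<otimes> (y \<otimes> D e c') = a (e + q) \<otimes> (x \<otimes> D e c)"
      using xy that cc by (simp add: m_ac)
    also have "\<dots> \<longleftrightarrow> y \<otimes> D e c' = x \<otimes> D e c"
      using xy that cc by simp
    also have "\<dots> \<longleftrightarrow> D e c' \<otimes> inv (D e c) = x \<otimes> inv y"
    proof -
      have "D e c' \<otimes> inv (D e c) = x \<otimes> inv y \<longleftrightarrow> D e c' = x \<otimes> inv y \<otimes> D e c"
        using xy that cc by (metis D_closed inv_closed inv_solve_right' m_closed)
      also have "\<dots> \<longleftrightarrow> D e c' = inv y \<otimes> (x \<otimes> D e c)"
        using xy that cc by (simp add: m_ac)
      also have "\<dots> \<longleftrightarrow> y \<otimes> D e c' = x \<otimes> D e c"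
        using xy that cc by (metis D_closed inv_solve_left m_closed)
      finally show ?thesis by simp
    qed
    finally show ?thesis .
  qed
  have "x \<otimes> inv y \<in> carrier G" using xy by simp
  then have "\<exists>!e. e \<in> {..<q} \<and> D e c' \<otimes> inv (D e c) = x \<otimes> inv y"
    using D_bij[OF cc(2,1,3)] unfolding bij_betw_iff_bijections
    by (metis (no_types, lifting))
  then show ?thesis
    using key unfolding v_def by (metis lessThan_iff)
qed

text \<open>The level is already determined modulo \<open>q ^ Suc t\<close>; one more digit is kept
  because coincidence also depends on digit \<open>t + 1\<close>.\<close>

definition level_residues :: "nat \<Rightarrow> nat \<Rightarrow> nat set" where
  "level_residues r t = {w. w < q ^ (t + 2) \<and> at_level q r t w}"

text \<open>The shift by \<open>q ^ (t + 2)\<close> avoids leading zeros, for which the recurrence of the sequence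
  fails.\<close>
definition zero_residues :: "nat \<Rightarrow> nat \<Rightarrow> nat set" where
  "zero_residues r t = {w \<in> level_residues r t. a (w + q ^ (t + 2) + r) = a (w + q ^ (t + 2))}"

lemma level_residues_less: "w \<in> level_residues r t \<Longrightarrow> w < q ^ (t + 2)"
  by (simp add: level_residues_def)

lemma zero_residues_subset: "zero_residues r t \<subseteq> level_residues r t"
  by (auto simp: zero_residues_def)

lemma level_residues_iff: "v mod q ^ (t + 2) \<in> level_residues r t \<longleftrightarrow> at_level q r t v"
  by (simp add: level_residues_def at_level_mod del: power_Suc)

text \<open>The shifted representative and \<open>v\<close> agree modulo \<open>q ^ (t + 2)\<close>,
  so \<open>a_eq_residue\<close> with \<open>s = Suc t\<close> transfers the coincidence between
  them.\<close>

lemma zero_residues_iff: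
  assumes "at_level q r t v" "q ^ Suc t \<le> v"
  shows "v mod q ^ (t + 2) \<in> zero_residues r t \<longleftrightarrow> a (v + r) = a v"
proof -
  let ?w = "v mod q ^ (t + 2) + q ^ (t + 2)"
  have m: "?w mod q ^ (t + 2) = v mod q ^ (t + 2)" by simp
  have "at_level q r t ?w"
    using assms(1) m at_level_mod[of q t "t + 2" r] by (metis less_add_same_cancel1 q_pos zero_less_numeral)
  moreover have "q ^ Suc t \<le> ?w"
    by (rule trans_le_add2, rule power_increasing) (use q_ge_2 in auto)
  ultimately have "a (?w + r) = a ?w \<longleftrightarrow> a (v + r) = a v"
    using assms m by (intro a_eq_residue[where s = "Suc t"]) (auto simp: at_level_def)
  moreover have "v mod q ^ (t + 2) \<in> level_residues r t"
    using assms(1) by (simp only: level_residues_iff)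
  ultimately show ?thesis by (simp only: zero_residues_def mem_Collect_eq simp_thms)
qed

text \<open>By \<open>ex1_digit\<close>, each residue of level \<open>t\<close> modulo
  \<open>q ^ Suc t\<close> has exactly one continuation by a digit \<open>t + 1\<close> that gives a
  coincidence. Deleting that digit is therefore a bijection.\<close>

lemma card_zero_residues:
  "card (zero_residues r t) = card {u. u < q ^ Suc t \<and> at_level q r t u}"
proof -
  let ?C = "{u. u < q ^ Suc t \<and> at_level q r t u}"
  let ?P = "\<lambda>u e. e < q \<and> a (u + q ^ Suc t * e + q ^ Suc (Suc t) + r) = a (u + q ^ Suc t * e + q ^ Suc (Suc t))"
  let ?e = "\<lambda>u. THE e. ?P u e"
  have P: "?P u (?e u)" if "u \<in> ?C" for u
    using theI'[OF ex1_digit[of u t r]] that by blast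
  have unique: "e = ?e u" if "u \<in> ?C" "?P u e" for u e
    using ex1_digit[of u t r] P[OF that(1)] that by blast
  have "bij_betw (\<lambda>w. w mod q ^ Suc t) (zero_residues r t) ?C"
  proof (rule bij_betw_byWitness[where f' = "\<lambda>u. u + q ^ Suc t * ?e u"])
    show "\<forall>w\<in>zero_residues r t. w mod q ^ Suc t + q ^ Suc t * ?e (w mod q ^ Suc t) = w"
    proof
      fix w assume w: "w \<in> zero_residues r t"
      have C: "w mod q ^ Suc t \<in> ?C"
        using w by (auto simp: zero_residues_def level_residues_def at_level_mod simp del: power_Suc)
      have "w < q ^ Suc t * q" using w by (simp add: zero_residues_def level_residues_def mult_ac)
      then have "w div q ^ Suc t < q" by (metis less_mult_imp_div_less mult.commute)
      moreover have "w mod q ^ Suc t + q ^ Suc t * (w div q ^ Suc t) = w" by (rule mod_mult_div_eq)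
      ultimately have "?P (w mod q ^ Suc t) (w div q ^ Suc t)"
        using w by (simp add: zero_residues_def del: power_Suc)
      then have "w div q ^ Suc t = ?e (w mod q ^ Suc t)" using unique[OF C] by blast
      then show "w mod q ^ Suc t + q ^ Suc t * ?e (w mod q ^ Suc t) = w"
        by (metis mod_mult_div_eq)
    qed
    show "\<forall>u\<in>?C. (u + q ^ Suc t * ?e u) mod q ^ Suc t = u" by (simp del: power_Suc)
    show "(\<lambda>w. w mod q ^ Suc t) ` zero_residues r t \<subseteq> ?C"
      by (auto simp: zero_residues_def level_residues_def at_level_mod simp del: power_Suc)
    show "(\<lambda>u. u + q ^ Suc t * ?e u) ` ?C \<subseteq> zero_residues r t"
    proof clarify
      fix u assume u: "u < q ^ Suc t" "at_level q r t u"
      then have Pu: "?P u (?e u)" using P by blast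
      let ?w = "u + q ^ Suc t * ?e u"
      have "?w < q ^ Suc t + q ^ Suc t * ?e u" using u by simp
      also have "\<dots> = q ^ Suc t * Suc (?e u)" by simp
      also have "\<dots> \<le> q ^ Suc t * q" using Pu by (intro mult_le_mono2) auto
      finally have "?w < q ^ (t + 2)" by (simp add: mult_ac)
      moreover have "at_level q r t ?w"
        using at_level_mod[of q t "Suc t" r ?w] u by (simp del: power_Suc)
      ultimately show "?w \<in> zero_residues r t"
        using Pu by (simp add: zero_residues_def level_residues_def)
    qed
  qed
  then show ?thesis by (rule bij_betw_same_card)
qed

text \<open>Digit \<open>t + 1\<close> is free for the level but unique for a coincidence, hence the
  factor \<open>q\<close>. This exact ratio is the source of the density
  \<open>1 / k\<close>.\<close>

lemma card_level_residues: "card (level_residues r t) = q * card (zero_residues r t)"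
proof -
  let ?C = "{u. u < q ^ Suc t \<and> at_level q r t u}"
  have "bij_betw (\<lambda>w. (w div q ^ Suc t, w mod q ^ Suc t)) (level_residues r t) ({..<q} \<times> ?C)"
  proof (rule bij_betw_byWitness[where f' = "\<lambda>(e, u). u + q ^ Suc t * e"])
    show "\<forall>w\<in>level_residues r t.
        (case (w div q ^ Suc t, w mod q ^ Suc t) of (e, u) \<Rightarrow> u + q ^ Suc t * e) = w"
      by (simp del: power_Suc)
    show "\<forall>eu\<in>{..<q} \<times> ?C. ((case eu of (e, u) \<Rightarrow> u + q ^ Suc t * e) div q ^ Suc t,
        (case eu of (e, u) \<Rightarrow> u + q ^ Suc t * e) mod q ^ Suc t) = eu"
      by (auto simp del: power_Suc)
    show "(\<lambda>w. (w div q ^ Suc t, w mod q ^ Suc t)) ` level_residues r t \<subseteq> {..<q} \<times> ?C"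
      by (auto simp: level_residues_def at_level_mod less_mult_imp_div_less mult_ac
          simp del: power_Suc) (simp_all add: less_mult_imp_div_less mult_ac)
    show "(\<lambda>(e, u). u + q ^ Suc t * e) ` ({..<q} \<times> ?C) \<subseteq> level_residues r t"
    proof (clarsimp simp del: power_Suc)
      fix e u assume u: "e < q" "u < q ^ Suc t" "at_level q r t u"
      let ?w = "u + q ^ Suc t * e"
      have "?w < q ^ Suc t + q ^ Suc t * e" using u by simp
      also have "\<dots> = q ^ Suc t * Suc e" by simp
      also have "\<dots> \<le> q ^ Suc t * q" using u by (intro mult_le_mono2) auto
      finally have "?w < q ^ (t + 2)" by (simp add: mult_ac)
      moreover have "at_level q r t ?w"
        using at_level_mod[of q t "Suc t" r ?w] u by (simp del: power_Suc)
      ultimately show "?w \<in> level_residues r t" by (simp add: level_residues_def)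
    qed
  qed
  then have "card (level_residues r t) = card ({..<q} \<times> ?C)" by (rule bij_betw_same_card)
  then show ?thesis by (simp add: card_cartesian_product card_zero_residues)
qed

lemma card_zero_residues_le: "card (zero_residues r t) \<le> q * r"
  unfolding card_zero_residues by (rule card_at_level_le) simp

end

section \<open>Counting in residue classes\<close>

text \<open>The offset \<open>m - 1 - v\<close> is chosen so that the quotient on the right jumps by
  one exactly when \<open>N + x\<close> is congruent to \<open>v\<close>. The value at
  \<open>N = 0\<close> stands on the left to avoid truncated subtraction.\<close>

lemma card_residue_class:
  fixes m :: nat
  assumes "v < m"
  shows "card {n. n < N \<and> (n + x) mod m = v} + (x + (m - 1 - v)) div m = (N + x + (m - 1 - v)) div m"
proof (induction N)
  case 0
  then show ?case by simp
next
  case (Suc N)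
  let ?c = "m - 1 - v"
  have "{n. n < Suc N \<and> (n + x) mod m = v} =
      (if (N + x) mod m = v then insert N {n. n < N \<and> (n + x) mod m = v}
       else {n. n < N \<and> (n + x) mod m = v})"
    by (auto simp: less_Suc_eq)
  then have card: "card {n. n < Suc N \<and> (n + x) mod m = v} =
      (if (N + x) mod m = v then 1 else 0) + card {n. n < N \<and> (n + x) mod m = v}"
    by simp
  have "Suc (N + x + ?c) mod m = 0 \<longleftrightarrow> (N + x) mod m = v"
  proof -
    have "Suc (N + x + ?c) + v = (N + x) + m" using assms by simp
    then have eq: "(Suc (N + x + ?c) + v) mod m = (N + x) mod m" by (simp only: mod_add_self2)
    show ?thesis
    proof
      assume "Suc (N + x + ?c) mod m = 0"
      then have "(Suc (N + x + ?c) + v) mod m = v mod m" by (metis add_0 mod_add_left_eq)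
      then show "(N + x) mod m = v" using eq assms by simp
    next
      assume "(N + x) mod m = v"
      then have "(Suc (N + x + ?c) + v) mod m = (0 + v) mod m" using eq assms by simp
      then have "[Suc (N + x + ?c) + v = 0 + v] (mod m)" by (simp add: cong_def)
      then show "Suc (N + x + ?c) mod m = 0"
        unfolding cong_add_rcancel_nat by (simp add: cong_def)
    qed
  qed
  then have "Suc (N + x + ?c) div m = (if (N + x) mod m = v then 1 else 0) + (N + x + ?c) div m"
    by (simp add: div_Suc)
  with Suc card show ?case by simp
qed

lemma card_residue_class_bound:
  fixes m :: nat
  assumes "v < m"
  shows "\<bar>real (card {n. n < N \<and> (n + x) mod m = v}) - real N / real m\<bar> \<le> 1"
proof -
  define A where "A = x + (m - 1 - v)"
  define y where "y = card {n. n < N \<and> (n + x) mod m = v}"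
  have m: "m > 0" using assms by simp
  have "y + A div m = (N + A) div m"
    using card_residue_class[OF assms, of N x] by (simp add: y_def A_def add.assoc)
  then have "(N + A) div m * m = y * m + A div m * m" by (metis add_mult_distrib)
  then have "y * m + A div m * m + (N + A) mod m = N + A" by (metis div_mult_mod_eq)
  then have "y * m + (N + A) mod m = N + A mod m"
    using div_mult_mod_eq[of A m] by linarith
  moreover have "(N + A) mod m < m" "A mod m < m" using m by simp_all
  ultimately have "y * m \<le> N + m" "N \<le> y * m + m" by linarith+
  then have "real y * real m \<le> real N + real m" "real N \<le> real y * real m + real m"
    by (metis of_nat_le_iff of_nat_add of_nat_mult)+
  then show ?thesis using m unfolding y_def[symmetric] abs_le_iff by (simp add: field_simps)
qed

lemma card_residues_bound:
  fixes m :: nat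
  assumes "R \<subseteq> {..<m}"
  shows "\<bar>real (card {n. n < N \<and> (n + x) mod m \<in> R}) - real N * real (card R) / real m\<bar> \<le> real (card R)"
proof -
  have fR: "finite R" using assms finite_subset by blast
  let ?S = "\<lambda>v. {n. n < N \<and> (n + x) mod m = v}"
  have "{n. n < N \<and> (n + x) mod m \<in> R} = (\<Union>v\<in>R. ?S v)" by auto
  then have "card {n. n < N \<and> (n + x) mod m \<in> R} = (\<Sum>v\<in>R. card (?S v))"
    using fR by (simp add: card_UN_disjoint disjoint_iff)
  then have "real (card {n. n < N \<and> (n + x) mod m \<in> R}) - real N * real (card R) / real m =
      (\<Sum>v\<in>R. real (card (?S v)) - real N / real m)"
    by (simp add: sum_subtractf)
  also have "\<bar>\<dots>\<bar> \<le> (\<Sum>v\<in>R. \<bar>real (card (?S v)) - real N / real m\<bar>)" by (rule sum_abs)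
  also have "\<dots> \<le> (\<Sum>v\<in>R. 1)"
    using assms by (intro sum_mono card_residue_class_bound) auto
  finally show ?thesis by simp
qed

text \<open>The Chinese remainder theorem as a bijection onto the extensional product of the sets
  \<open>R i\<close>.\<close>

lemma card_simultaneous_residues:
  fixes m :: "'i \<Rightarrow> nat"
  assumes "finite I" and m: "\<And>i. i \<in> I \<Longrightarrow> m i > 0"
    and cop: "\<And>i j. i \<in> I \<Longrightarrow> j \<in> I \<Longrightarrow> i \<noteq> j \<Longrightarrow> coprime (m i) (m j)"
    and R: "\<And>i. i \<in> I \<Longrightarrow> R i \<subseteq> {..<m i}"
  shows "card {w. w < (\<Prod>i\<in>I. m i) \<and> (\<forall>i\<in>I. w mod m i \<in> R i)} = (\<Prod>i\<in>I. card (R i))"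
proof -
  let ?W = "{w. w < (\<Prod>i\<in>I. m i) \<and> (\<forall>i\<in>I. w mod m i \<in> R i)}"
  have "bij_betw (\<lambda>w. \<lambda>i\<in>I. w mod m i) ?W (PiE I R)"
  proof (rule bij_betwI')
    fix w w' assume w: "w \<in> ?W" "w' \<in> ?W"
    show "(\<lambda>i\<in>I. w mod m i) = (\<lambda>i\<in>I. w' mod m i) \<longleftrightarrow> w = w'"
    proof
      assume eq: "(\<lambda>i\<in>I. w mod m i) = (\<lambda>i\<in>I. w' mod m i)"
      have "[w = w'] (mod (\<Prod>i\<in>I. m i))"
      proof (rule coprime_cong_prod_nat)
        show "[w = w'] (mod m i)" if "i \<in> I" for i
          using fun_cong[OF eq, of i] that by (simp add: cong_def)
      qed (use cop in auto)
      then show "w = w'" using w by (simp add: cong_def)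
    qed simp
  next
    fix w assume "w \<in> ?W"
    then show "(\<lambda>i\<in>I. w mod m i) \<in> PiE I R" by auto
  next
    fix f assume f: "f \<in> PiE I R"
    have "\<exists>!w. w < (\<Prod>i\<in>I. m i) \<and> (\<forall>i\<in>I. [w = f i] (mod m i))"
      by (rule chinese_remainder_unique_nat) (use assms(1) m cop in auto)
    then obtain w where w: "w < (\<Prod>i\<in>I. m i)" "\<forall>i\<in>I. [w = f i] (mod m i)" by blast
    have fw: "w mod m i = f i" if "i \<in> I" for i
      using w(2) that R[OF that] PiE_mem[OF f that] by (auto simp: cong_def subset_iff)
    have "w \<in> ?W" using w(1) f by (simp add: fw PiE_mem)
    moreover have "f = (\<lambda>i\<in>I. w mod m i)"
    proof
      fix i
      show "f i = (\<lambda>i\<in>I. w mod m i) i"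
        using fw PiE_arb[OF f] by (cases "i \<in> I") simp_all
    qed
    ultimately show "\<exists>w\<in>?W. f = (\<lambda>i\<in>I. w mod m i)" by blast
  qed
  then have "card ?W = card (PiE I R)" by (rule bij_betw_same_card)
  then show ?thesis using assms(1) by (simp add: card_PiE)
qed

text \<open>The conditions merge into one set of residues modulo the product of the moduli, and each
  such residue contributes an error of at most one.\<close>

lemma card_simultaneous_residues_bound:
  fixes m :: "'i \<Rightarrow> nat"
  assumes "finite I" and m: "\<And>i. i \<in> I \<Longrightarrow> m i > 0"
    and cop: "\<And>i j. i \<in> I \<Longrightarrow> j \<in> I \<Longrightarrow> i \<noteq> j \<Longrightarrow> coprime (m i) (m j)"
    and R: "\<And>i. i \<in> I \<Longrightarrow> R i \<subseteq> {..<m i}"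
  shows "\<bar>real (card {n. n < N \<and> (\<forall>i\<in>I. (n + x) mod m i \<in> R i)}) -
      real N * real (\<Prod>i\<in>I. card (R i)) / real (\<Prod>i\<in>I. m i)\<bar> \<le> real (\<Prod>i\<in>I. card (R i))"
proof -
  let ?M = "\<Prod>i\<in>I. m i"
  let ?W = "{w. w < ?M \<and> (\<forall>i\<in>I. w mod m i \<in> R i)}"
  have "?M > 0" using m by (simp add: prod_pos)
  then have "(n + x) mod ?M \<in> ?W \<longleftrightarrow> (\<forall>i\<in>I. (n + x) mod m i \<in> R i)" for n
    using assms(1) by (simp add: mod_mod_cancel dvd_prodI)
  then have "{n. n < N \<and> (\<forall>i\<in>I. (n + x) mod m i \<in> R i)} = {n. n < N \<and> (n + x) mod ?M \<in> ?W}"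
    by blast
  moreover have "\<bar>real (card {n. n < N \<and> (n + x) mod ?M \<in> ?W}) - real N * real (card ?W) / real ?M\<bar>
      \<le> real (card ?W)"
    by (rule card_residues_bound) auto
  moreover have "card ?W = (\<Prod>i\<in>I. card (R i))"
    by (rule card_simultaneous_residues) (use assms in auto)
  ultimately show ?thesis by simp
qed

text \<open>Scaling by the product of the \<open>q i\<close> makes the two main terms identical, so
  only the two rounding errors remain, each at most the product of the
  \<open>card (A i)\<close>.\<close>

lemma compare_simultaneous_residues:
  fixes m :: "'i \<Rightarrow> nat"
  assumes "finite I" and m: "\<And>i. i \<in> I \<Longrightarrow> m i > 0"
    and cop: "\<And>i j. i \<in> I \<Longrightarrow> j \<in> I \<Longrightarrow> i \<noteq> j \<Longrightarrow> coprime (m i) (m j)"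
    and A: "\<And>i. i \<in> I \<Longrightarrow> A i \<subseteq> {..<m i}" and B: "\<And>i. i \<in> I \<Longrightarrow> B i \<subseteq> {..<m i}"
    and card: "\<And>i. i \<in> I \<Longrightarrow> card (A i) = q i * card (B i)"
  shows "\<bar>real (\<Prod>i\<in>I. q i) * real (card {n. n < N \<and> (\<forall>i\<in>I. (n + x) mod m i \<in> B i)}) -
      real (card {n. n < N \<and> (\<forall>i\<in>I. (n + x) mod m i \<in> A i)})\<bar> \<le> 2 * real (\<Prod>i\<in>I. card (A i))"
proof -
  let ?k = "real (\<Prod>i\<in>I. q i)" and ?M = "real (\<Prod>i\<in>I. m i)"
  let ?a = "real (\<Prod>i\<in>I. card (A i))" and ?b = "real (\<Prod>i\<in>I. card (B i))"
  let ?CA = "real (card {n. n < N \<and> (\<forall>i\<in>I. (n + x) mod m i \<in> A i)})"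
  let ?CB = "real (card {n. n < N \<and> (\<forall>i\<in>I. (n + x) mod m i \<in> B i)})"
  have a: "?a = ?k * ?b" using card by (simp add: prod.distrib)
  have "\<bar>?CB - real N * ?b / ?M\<bar> \<le> ?b"
    by (rule card_simultaneous_residues_bound) (use assms in auto)
  then have "?k * \<bar>?CB - real N * ?b / ?M\<bar> \<le> ?k * ?b" by (rule mult_left_mono) (simp add: prod_nonneg)
  then have "\<bar>?k * (?CB - real N * ?b / ?M)\<bar> \<le> ?a" unfolding a by (simp add: abs_mult prod_nonneg)
  then have "\<bar>?k * ?CB - real N * ?a / ?M\<bar> \<le> ?a" unfolding a by (simp add: algebra_simps)
  moreover have "\<bar>?CA - real N * ?a / ?M\<bar> \<le> ?a"
    by (rule card_simultaneous_residues_bound) (use assms in auto)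
  ultimately show ?thesis by linarith
qed

section \<open>Summation over tuples of levels\<close>

lemma card_choice:
  assumes "finite I" "finite U" "\<And>i. i \<in> I \<Longrightarrow> finite (L i)"
    and unique: "\<And>i s t n. i \<in> I \<Longrightarrow> P i s n \<Longrightarrow> P i t n \<Longrightarrow> s = t"
  shows "card {n \<in> U. \<forall>i\<in>I. \<exists>t\<in>L i. P i t n} = (\<Sum>\<tau>\<in>PiE I L. card {n \<in> U. \<forall>i\<in>I. P i (\<tau> i) n})"
proof -
  let ?S = "\<lambda>\<tau>. {n \<in> U. \<forall>i\<in>I. P i (\<tau> i) n}"
  have "{n \<in> U. \<forall>i\<in>I. \<exists>t\<in>L i. P i t n} = (\<Union>\<tau>\<in>PiE I L. ?S \<tau>)"
  proof (intro equalityI subsetI)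
    fix n assume n: "n \<in> {n \<in> U. \<forall>i\<in>I. \<exists>t\<in>L i. P i t n}"
    then obtain f where "\<forall>i\<in>I. f i \<in> L i \<and> P i (f i) n"
      using bchoice[of I "\<lambda>i t. t \<in> L i \<and> P i t n"] by auto
    then have "restrict f I \<in> PiE I L" "n \<in> ?S (restrict f I)" using n by auto
    then show "n \<in> (\<Union>\<tau>\<in>PiE I L. ?S \<tau>)" by blast
  qed (auto simp: PiE_mem)
  \<comment> \<open>An \<open>n\<close> in both sets would have two different indices at a place
    where the tuples differ.\<close>
  moreover have "?S \<sigma> \<inter> ?S \<tau> = {}" if \<sigma>\<tau>: "\<sigma> \<in> PiE I L" "\<tau> \<in> PiE I L" "\<sigma> \<noteq> \<tau>" for \<sigma> \<tau>
  proof -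
    obtain i where "i \<in> I" "\<sigma> i \<noteq> \<tau> i" using PiE_ext[OF \<sigma>\<tau>(1,2)] \<sigma>\<tau>(3) by blast
    then show ?thesis using unique by blast
  qed
  ultimately show ?thesis
    using assms(1-3) by (simp add: card_UN_disjoint finite_PiE)
qed

text \<open>The exceptions fill at most \<open>r\<close> residue classes modulo
  \<open>q ^ T\<close>, those within \<open>r\<close> of the top.\<close>

lemma card_not_same_block:
  assumes "q > 0"
  shows "real (card {n. n < N \<and> \<not> same_block q r T (n + x)}) \<le> real N * real r / real (q ^ T) + real r"
proof -
  let ?R = "{w. w < q ^ T \<and> q ^ T \<le> w + r}"
  have eq: "{n. n < N \<and> \<not> same_block q r T (n + x)} = {n. n < N \<and> (n + x) mod q ^ T \<in> ?R}"
    using assms by (auto simp: same_block_iff)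
  have "\<bar>real (card {n. n < N \<and> (n + x) mod q ^ T \<in> ?R}) - real N * real (card ?R) / real (q ^ T)\<bar>
      \<le> real (card ?R)"
    by (rule card_residues_bound) auto
  then have "real (card {n. n < N \<and> \<not> same_block q r T (n + x)}) \<le>
      real N * real (card ?R) / real (q ^ T) + real (card ?R)" unfolding eq by linarith
  also have "\<dots> \<le> real N * real r / real (q ^ T) + real r"
    using card_upper_residues[of "q ^ T" r] by (intro add_mono divide_right_mono mult_left_mono) auto
  finally show ?thesis .
qed

lemma card_symmetric_difference_le:
  assumes "finite A" "finite B" "A - B \<subseteq> E" "B - A \<subseteq> E" "finite E"
  shows "\<bar>real (card A) - real (card B)\<bar> \<le> real (card E)"
proof -
  have "card A \<le> card (B \<union> E)" "card B \<le> card (A \<union> E)" using assms by (auto intro!: card_mono)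
  then show ?thesis using card_Un_le[of B E] card_Un_le[of A E] by linarith
qed

text \<open>Three comparisons are chained, with \<open>k\<close> the product of the
  \<open>q i\<close>: \<open>k * card Z\<close> with \<open>k * card h\<close>, then with
  \<open>card g\<close>, then with \<open>N\<close>. The outer two cost the exceptional set
  \<open>k\<close> times and once, hence the factor \<open>k + 1\<close>; the middle one is summed
  over all tuples of levels. The cutoffs \<open>T i\<close> stay free.\<close>

lemma count_coincidences:
  fixes G :: "'i \<Rightarrow> 'a monoid" and q T :: "'i \<Rightarrow> nat"
  assumes fin: "finite I"
    and rs: "\<And>i. i \<in> I \<Longrightarrow> rs_system (G i) (q i) (D i) (a i)"
    and cop: "\<And>i j. i \<in> I \<Longrightarrow> j \<in> I \<Longrightarrow> i \<noteq> j \<Longrightarrow> coprime (q i) (q j)"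
    and r: "r > 0"
  shows "\<bar>real (\<Prod>i\<in>I. q i) * real (card {n. n < N \<and> (\<forall>i\<in>I. a i (n + x + r) = a i (n + x))}) - real N\<bar>
    \<le> (real (\<Prod>i\<in>I. q i) + 1) * (\<Sum>i\<in>I. real N * real r / real (q i ^ T i) + real r + real (q i ^ T i))
      + 2 * real (\<Prod>i\<in>I. card {t. t < T i \<and> r < q i ^ Suc t} * ((q i)\<^sup>2 * r))"
proof -
  \<comment> \<open>Any level that occurs satisfies \<open>r < q i ^ Suc t\<close>; recording this
    bounds the number of levels in terms of the cutoff relative to \<open>r\<close>.\<close>
  define L where "L i = {t. t < T i \<and> r < q i ^ Suc t}" for i
  define A where "A i t = rs_system.level_residues (q i) r t" for i t
  define B where "B i t = rs_system.zero_residues (q i) (a i) r t" for i t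
  let ?m = "\<lambda>i t. q i ^ (t + 2)"
  let ?k = "real (\<Prod>i\<in>I. q i)"
  define Z where "Z = {n. n < N \<and> (\<forall>i\<in>I. a i (n + x + r) = a i (n + x))}"
  define g where "g = {n. n < N \<and> (\<forall>i\<in>I. \<exists>t\<in>L i. (n + x) mod ?m i t \<in> A i t)}"
  define h where "h = {n. n < N \<and> (\<forall>i\<in>I. \<exists>t\<in>L i. (n + x) mod ?m i t \<in> B i t)}"
  \<comment> \<open>Two kinds of exceptions: in \<open>bad i\<close> there is no level below the
    cutoff, and in \<open>small i\<close> the argument may be too short for
    \<open>B_iff\<close>.\<close>
  define bad where "bad i = {n. n < N \<and> \<not> same_block (q i) r (T i) (n + x)}" for i
  define small where "small i = {n. n + x < q i ^ T i}" for i
  have fins: "finite Z" "finite g" "finite h" "finite (bad i)" for i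
    by (simp_all add: Z_def g_def h_def bad_def)
  have fin_small: "finite (small i)" for i
    by (rule finite_subset[of _ "{..<q i ^ T i}"]) (auto simp: small_def)
  have q: "q i > 0" if "i \<in> I" for i using rs_system.q_pos[OF rs[OF that]] .
  have A_iff: "v mod ?m i t \<in> A i t \<longleftrightarrow> at_level (q i) r t v" if "i \<in> I" for i t v
    unfolding A_def by (rule rs_system.level_residues_iff[OF rs[OF that]])
  have BA: "B i t \<subseteq> A i t" if "i \<in> I" for i t
    unfolding A_def B_def by (rule rs_system.zero_residues_subset[OF rs[OF that]])
  have A_sub: "A i t \<subseteq> {..<?m i t}" if "i \<in> I" for i t
    unfolding A_def using rs_system.level_residues_less[OF rs[OF that]] by auto
  have card_AB: "card (A i t) = q i * card (B i t)" if "i \<in> I" for i t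
    unfolding A_def B_def by (rule rs_system.card_level_residues[OF rs[OF that]])
  have card_A: "card (A i t) \<le> (q i)\<^sup>2 * r" if "i \<in> I" for i t
    unfolding card_AB[OF that] using rs_system.card_zero_residues_le[OF rs[OF that], of r t]
    by (simp add: B_def power2_eq_square)
  have B_iff: "v mod ?m i t \<in> B i t \<longleftrightarrow> a i (v + r) = a i v"
    if "i \<in> I" "at_level (q i) r t v" "q i ^ Suc t \<le> v" for i t v
    unfolding B_def by (rule rs_system.zero_residues_iff[OF rs[OF that(1)] that(2,3)])
  have lev: "\<exists>t\<in>L i. at_level (q i) r t v" if "i \<in> I" "same_block (q i) r (T i) v" for i v
    using ex_at_level[OF r that(2)] at_level_imp_less[OF q[OF that(1)]] by (auto simp: L_def)
  have finL: "finite (L i)" for i by (simp add: L_def)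

  let ?cA = "\<lambda>\<tau>. card {n \<in> {..<N}. \<forall>i\<in>I. (n + x) mod ?m i (\<tau> i) \<in> A i (\<tau> i)}"
  let ?cB = "\<lambda>\<tau>. card {n \<in> {..<N}. \<forall>i\<in>I. (n + x) mod ?m i (\<tau> i) \<in> B i (\<tau> i)}"
  have cg: "card g = (\<Sum>\<tau>\<in>PiE I L. ?cA \<tau>)"
  proof -
    have "card {n \<in> {..<N}. \<forall>i\<in>I. \<exists>t\<in>L i. (n + x) mod ?m i t \<in> A i t} = (\<Sum>\<tau>\<in>PiE I L. ?cA \<tau>)"
      by (rule card_choice) (use fin finL A_iff at_level_unique in auto)
    then show ?thesis by (simp add: g_def)
  qed
  have ch: "card h = (\<Sum>\<tau>\<in>PiE I L. ?cB \<tau>)"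
  proof -
    have "card {n \<in> {..<N}. \<forall>i\<in>I. \<exists>t\<in>L i. (n + x) mod ?m i t \<in> B i t} = (\<Sum>\<tau>\<in>PiE I L. ?cB \<tau>)"
      by (rule card_choice) (use fin finL A_iff BA at_level_unique in blast)+
    then show ?thesis by (simp add: h_def)
  qed
  have each: "\<bar>?k * real (?cB \<tau>) - real (?cA \<tau>)\<bar> \<le> 2 * real (\<Prod>i\<in>I. (q i)\<^sup>2 * r)" for \<tau>
  proof -
    have "\<bar>?k * real (?cB \<tau>) - real (?cA \<tau>)\<bar> \<le> 2 * real (\<Prod>i\<in>I. card (A i (\<tau> i)))"
      unfolding lessThan_iff
    proof (rule compare_simultaneous_residues)
      show "B i (\<tau> i) \<subseteq> {..<?m i (\<tau> i)}" if "i \<in> I" for i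
        using BA[OF that] A_sub[OF that] by blast
      show "coprime (?m i (\<tau> i)) (?m j (\<tau> j))" if "i \<in> I" "j \<in> I" "i \<noteq> j" for i j
        using cop[OF that] by (simp del: power_add)
      show "0 < ?m i (\<tau> i)" if "i \<in> I" for i using q[OF that] by simp
    qed (use fin A_sub card_AB in auto)
    also have "(\<Prod>i\<in>I. card (A i (\<tau> i))) \<le> (\<Prod>i\<in>I. (q i)\<^sup>2 * r)"
      using card_A by (intro prod_mono) auto
    finally show ?thesis by simp
  qed
  have hg_sum: "?k * real (card h) - real (card g) = (\<Sum>\<tau>\<in>PiE I L. ?k * real (?cB \<tau>) - real (?cA \<tau>))"
    unfolding cg ch by (simp add: sum_subtractf sum_distrib_left)
  have "\<bar>?k * real (card h) - real (card g)\<bar> \<le> (\<Sum>\<tau>\<in>PiE I L. \<bar>?k * real (?cB \<tau>) - real (?cA \<tau>)\<bar>)"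
    unfolding hg_sum by (rule sum_abs)
  also have "\<dots> \<le> (\<Sum>\<tau>\<in>PiE I L. 2 * real (\<Prod>i\<in>I. (q i)\<^sup>2 * r))"
    by (rule sum_mono) (rule each)
  also have "\<dots> = 2 * real (\<Prod>i\<in>I. card (L i) * ((q i)\<^sup>2 * r))"
    using fin by (simp add: card_PiE prod.distrib)
  finally have hg: "\<bar>?k * real (card h) - real (card g)\<bar> \<le> 2 * real (\<Prod>i\<in>I. card (L i) * ((q i)\<^sup>2 * r))" .

  let ?E = "(\<Union>i\<in>I. bad i \<union> small i)"
  let ?e = "\<Sum>i\<in>I. real N * real r / real (q i ^ T i) + real r + real (q i ^ T i)"
  have "card ?E \<le> (\<Sum>i\<in>I. card (bad i \<union> small i))" by (rule card_UN_le[OF fin])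
  also have "\<dots> \<le> (\<Sum>i\<in>I. card (bad i) + card (small i))" by (intro sum_mono card_Un_le)
  finally have "real (card ?E) \<le> (\<Sum>i\<in>I. real (card (bad i)) + real (card (small i)))"
    by (simp flip: of_nat_add of_nat_sum)
  also have "\<dots> \<le> ?e"
  proof (intro sum_mono add_mono)
    show "real (card (bad i)) \<le> real N * real r / real (q i ^ T i) + real r" if "i \<in> I" for i
      unfolding bad_def by (rule card_not_same_block[OF q[OF that]])
    have "card (small i) \<le> card {..<q i ^ T i}" for i
      by (rule card_mono) (auto simp: small_def)
    then show "real (card (small i)) \<le> real (q i ^ T i)" for i by simp
  qed
  finally have E: "real (card ?E) \<le> ?e" .
  have finE: "finite ?E" using fin fins fin_small by simp
  have good: "(\<exists>t\<in>L i. (n + x) mod ?m i t \<in> A i t) \<and>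
      ((\<exists>t\<in>L i. (n + x) mod ?m i t \<in> B i t) \<longleftrightarrow> a i (n + x + r) = a i (n + x))"
    if i: "i \<in> I" and n: "n < N" "n \<notin> ?E" for i n
  proof -
    have "same_block (q i) r (T i) (n + x)" "q i ^ T i \<le> n + x"
      using i n by (auto simp: bad_def small_def)
    obtain t where t: "t \<in> L i" "at_level (q i) r t (n + x)"
      using lev[OF i] \<open>same_block _ _ _ _\<close> by blast
    have "q i ^ Suc t \<le> q i ^ T i"
      using t(1) q[OF i] by (intro power_increasing) (auto simp: L_def)
    then have iff: "(n + x) mod ?m i t \<in> B i t \<longleftrightarrow> a i (n + x + r) = a i (n + x)"
      using t(2) \<open>q i ^ T i \<le> n + x\<close> by (intro B_iff i) auto
    \<comment> \<open>Membership at any \<open>s\<close> makes \<open>s\<close> a level, so the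
      existential over levels reduces to the single \<open>t\<close>.\<close>
    moreover have "s = t" if "(n + x) mod ?m i s \<in> B i s" for s
      using that BA[OF i] A_iff[OF i] t(2) at_level_unique by blast
    ultimately show ?thesis using t A_iff[OF i] by blast
  qed
  have Zh: "\<bar>real (card Z) - real (card h)\<bar> \<le> real (card ?E)"
  proof (rule card_symmetric_difference_le)
    show "Z - h \<subseteq> ?E" "h - Z \<subseteq> ?E" using good by (auto simp: Z_def h_def) 
  qed (use fins finE in auto)
  have gN: "\<bar>real (card g) - real N\<bar> \<le> real (card ?E)"
  proof -
    have "\<bar>real (card g) - real (card {..<N})\<bar> \<le> real (card ?E)"
    proof (rule card_symmetric_difference_le)
      show "{..<N} - g \<subseteq> ?E" using good by (auto simp: g_def)
    qed (use fins finE in \<open>auto simp: g_def\<close>)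
    then show ?thesis by simp
  qed
  have "\<bar>?k * real (card Z) - ?k * real (card h)\<bar> \<le> ?k * ?e"
    unfolding right_diff_distrib[symmetric] abs_mult using Zh E by (intro mult_mono) (auto intro!: prod_nonneg)
  then show ?thesis
    using hg gN E unfolding Z_def[symmetric] L_def[symmetric] distrib_right by linarith
qed

section \<open>Size of the error terms\<close>

text \<open>Between the least level \<open>s\<close> and the greatest level \<open>t\<close>, the
  powers of \<open>q\<close> grow from above \<open>r\<close> to below \<open>X\<close>, so
  \<open>t - s\<close> is at most logarithmic in \<open>X / r\<close>.\<close>

lemma card_levels_le:
  assumes "2 \<le> q" "1 \<le> r" "real r \<le> X" "\<And>t. t < T \<Longrightarrow> real q ^ t < X"
  shows "real (card {t. t < T \<and> r < q ^ Suc t}) \<le> 2 * (1 + ln (X / real r))"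
proof -
  let ?L = "{t. t < T \<and> r < q ^ Suc t}"
  have ln0: "0 \<le> ln (X / real r)" using assms by simp
  show ?thesis
  proof (cases "?L = {}")
    case True
    then show ?thesis using ln0 by (simp only: card.empty) simp
  next
    case False
    have fin: "finite ?L" by simp
    define s where "s = Min ?L"
    define t where "t = Max ?L"
    have s: "s \<in> ?L" and t: "t \<in> ?L" using Min_in[OF fin False] Max_in[OF fin False]
      unfolding s_def t_def by auto
    have "?L \<subseteq> {s..t}" unfolding s_def t_def using fin by (auto intro: Min_le Max_ge)
    then have c: "card ?L \<le> Suc t - s" by (metis card_atLeastAtMost card_mono finite_atLeastAtMost)
    \<comment> \<open>The bound \<open>r < q ^ Suc s\<close> starts the growth at
      \<open>Suc s\<close>. For \<open>s = t\<close> the truncated difference is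
      \<open>0\<close>.\<close>
    have ln2: "real (t - Suc s) * ln 2 \<le> ln (X / real r)"
    proof (cases "Suc s \<le> t")
      case True
      have "real r * 2 ^ (t - Suc s) \<le> real (q ^ Suc s) * real q ^ (t - Suc s)"
        using s assms(1) by (intro mult_mono power_mono) (auto simp del: power_Suc)
      also have "\<dots> = real q ^ t" using True by (simp add: power_add[symmetric] del: power_Suc)
      also have "\<dots> \<le> X" using assms(4)[of t] t by simp
      finally have "2 ^ (t - Suc s) \<le> X / real r" using assms(2) by (simp add: field_simps)
      then have "ln (2 ^ (t - Suc s)) \<le> ln (X / real r)"
        by (rule ln_mono[rotated 2, OF _]) simp_all
      then show ?thesis by (simp add: ln_realpow)
    next
      case False
      then show ?thesis using ln0 by simp
    qed
    \<comment> \<open>Obtained from \<open>ln (1 / 2) \<le> - 1 / 2\<close>; its reciprocal is the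
      factor 2 in the lemma.\<close>
    have "1 / 2 \<le> ln (2::real)"
      using ln_le_minus_one[of "1 / 2 :: real"] by (simp add: ln_div)
    then have "real (t - Suc s) * (1 / 2) \<le> real (t - Suc s) * ln 2"
      by (rule mult_left_mono) simp
    also note ln2
    finally have "real (t - Suc s) \<le> 2 * ln (X / real r)" by simp
    moreover have "real (card ?L) \<le> 2 + real (t - Suc s)" using c by linarith
    ultimately show ?thesis by (simp only: distrib_left mult_1_right)
  qed
qed

text \<open>The least exponent whose power reaches \<open>X\<close> works: the preceding power is
  below \<open>X\<close>, so one more factor \<open>q\<close> overshoots by at most
  \<open>q\<close>.\<close>

lemma ex_level_bound:
  assumes "2 \<le> q" "1 \<le> (X::real)"
  shows "\<exists>T. X \<le> real q ^ T \<and> real q ^ T \<le> real q * X \<and> (\<forall>t<T. real q ^ t < X)"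
proof -
  define T where "T = (LEAST T. X \<le> real q ^ T)"
  obtain n where "X < real q ^ n" using real_arch_pow[of "real q" X] assms by auto
  then have ge: "X \<le> real q ^ T"
    using LeastI[of "\<lambda>T. X \<le> real q ^ T" n] by (simp add: T_def)
  have less: "real q ^ t < X" if "t < T" for t
    using not_less_Least[of t "\<lambda>T. X \<le> real q ^ T"] that by (simp add: T_def)
  have "real q ^ T \<le> real q * X"
  proof (cases T)
    case 0
    have "1 * 1 \<le> real q * X" using assms by (intro mult_mono) auto
    then show ?thesis using 0 by simp
  next
    case (Suc t)
    then show ?thesis using less[of t] by (simp add: mult_left_mono less_imp_le)
  qed
  then show ?thesis using ge less by blast
qed

section \<open>Rudin--Shapiro sequences\<close>

lemma comm_group_Zp_power: "comm_group (Zp_power p m)"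
proof (rule group.group_comm_groupI)
  show "Group.group (Zp_power p m)" by (simp add: Zp_power_def)
qed (auto simp: Zp_power_def add.commute)

lemma card_Zp_power:
  assumes "p > 0"
  shows "card (carrier (Zp_power p m)) = p ^ m" "finite (carrier (Zp_power p m))"
  using assms by (simp_all add: Zp_power_def carrier_integer_mod_group card_PiE finite_PiE)

text \<open>Sorting the \<open>q\<close> rows by their difference gives
  \<open>q * \<mu> = q\<close>, so every element is attained; a surjection between finite sets of
  equal size is injective.\<close>

lemma difference_matrix_bij:
  fixes G (structure)
  assumes G: "Group.group G" "finite (carrier G)" "card (carrier G) = q"
    and D: "D \<in> difference_matrices q q G" and ij: "i < q" "j < q" "i \<noteq> j"
  shows "bij_betw (\<lambda>l. D l i \<otimes> inv D l j) {..<q} (carrier G)"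
proof -
  interpret group G by fact
  let ?f = "\<lambda>l. D l i \<otimes> inv D l j"
  have cl: "?f ` {..<q} \<subseteq> carrier G"
    using D ij by (auto simp: difference_matrices_def)
  obtain \<mu> where \<mu>: "\<forall>x\<in>carrier G. card {l. l < q \<and> ?f l = x} = \<mu>"
    using D ij unfolding difference_matrices_def by blast
  have "(\<Sum>x\<in>carrier G. card {l \<in> {..<q}. ?f l = x}) = card {..<q}"
    using sum.group[of "{..<q}" "carrier G" ?f "\<lambda>_. 1::nat"] G cl by simp
  then have "q * \<mu> = q" using \<mu> G by simp
  then have "\<mu> = 1" using ij by simp
  have "carrier G \<subseteq> ?f ` {..<q}"
  proof
    fix x assume "x \<in> carrier G"
    then have "card {l. l < q \<and> ?f l = x} = 1" using \<mu> \<open>\<mu> = 1\<close> by simp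
    then have "{l. l < q \<and> ?f l = x} \<noteq> {}" by (metis card.empty zero_neq_one)
    then show "x \<in> ?f ` {..<q}" by auto
  qed
  with cl have img: "?f ` {..<q} = carrier G" by blast
  then have "inj_on ?f {..<q}" using G by (intro eq_card_imp_inj_on) auto
  with img show ?thesis by (simp add: bij_betw_def)
qed

text \<open>Division with remainder by \<open>p ^ m\<close> turns the two-variable recurrence into
  \<open>a_rec\<close>; the excluded pair \<open>(0, 0)\<close> corresponds to
  \<open>n = 0\<close>.\<close>

lemma rudin_shapiro_rs_system:
  assumes p: "prime p" and m: "m > 0"
    and M: "M \<in> difference_matrices (p ^ m) (p ^ m) (Zp_power p m)"
    and a: "rudin_shapiro p m M a"
  shows "rs_system (Zp_power p m) (p ^ m) M a"
proof -
  interpret comm_group "Zp_power p m" by (rule comm_group_Zp_power)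
  have p0: "p > 0" using p by (simp add: prime_gt_0_nat)
  show ?thesis
  proof
    have "2 ^ 1 \<le> p ^ 1" using p by (simp add: prime_ge_2_nat)
    also have "\<dots> \<le> p ^ m" using p0 m by (intro power_increasing) auto
    finally show "2 \<le> p ^ m" by simp
    show "M l i \<in> carrier (Zp_power p m)" if "l < p ^ m" "i < p ^ m" for l i
      using M that by (auto simp: difference_matrices_def)
    show "bij_betw (\<lambda>l. M l i \<otimes>\<^bsub>Zp_power p m\<^esub> inv\<^bsub>Zp_power p m\<^esub> M l j) {..<p ^ m} (carrier (Zp_power p m))"
      if "i < p ^ m" "j < p ^ m" "i \<noteq> j" for i j
      using difference_matrix_bij[OF is_group card_Zp_power(2,1)[OF p0] M that] .
    show "a n \<in> carrier (Zp_power p m)" for n using a by (simp add: rudin_shapiro_def)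
    show "a n = a (n div p ^ m) \<otimes>\<^bsub>Zp_power p m\<^esub> M (n div p ^ m mod p ^ m) (n mod p ^ m)" if "n \<noteq> 0" for n
    proof -
      have "(n mod p ^ m, n div p ^ m) \<noteq> (0, 0)"
        using that by (metis div_mult_mod_eq add_0 mult_0 prod.inject)
      moreover have "n mod p ^ m < p ^ m" using p0 by simp
      ultimately have "a (p ^ m * (n div p ^ m) + n mod p ^ m) =
          a (n div p ^ m) \<otimes>\<^bsub>Zp_power p m\<^esub> rs_g p m M (n mod p ^ m) (n div p ^ m)"
        using a unfolding rudin_shapiro_def by blast
      then show ?thesis by (simp add: rs_g_def)
    qed
  qed
qed

section \<open>The discrepancy sum and the final estimate\<close>

lemma sum_discrepancy:
  "(\<Sum>n<N. discrepancy (combined_seq d a) (n + r1) (n + r2)) =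
    real N - real (card {n. n < N \<and> (\<forall>i\<in>{1..d}. a i (n + r2) = a i (n + r1))})"
proof -
  have eq: "combined_seq d a u = combined_seq d a v \<longleftrightarrow> (\<forall>i\<in>{1..d}. a i v = a i u)" for u v
    unfolding combined_seq_def by (auto simp: fun_eq_iff restrict_def)
  have "discrepancy (combined_seq d a) u v = 1 - (if \<forall>i\<in>{1..d}. a i v = a i u then 1 else 0)" for u v
    unfolding discrepancy_def eq by simp
  then have "(\<Sum>n<N. discrepancy (combined_seq d a) (n + r1) (n + r2)) =
      real N - (\<Sum>n<N. if \<forall>i\<in>{1..d}. a i (n + r2) = a i (n + r1) then 1 else 0)"
    by (simp add: sum_subtractf)
  also have "(\<Sum>n<N. if \<forall>i\<in>{1..d}. a i (n + r2) = a i (n + r1) then 1 else 0) =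
      real (card {n. n < N \<and> (\<forall>i\<in>{1..d}. a i (n + r2) = a i (n + r1))})"
    by (subst sum.inter_filter[symmetric]) simp_all
  finally show ?thesis .
qed

text \<open>Everything is measured against \<open>r * (1 + L) * Y\<close> with
  \<open>L = ln (X / r)\<close>, using \<open>X \<le> Y\<close> and
  \<open>1 \<le> r * (1 + L) \<le> X\<close>.\<close>

lemma error_terms_le:
  fixes q T :: "nat \<Rightarrow> nat" and d k r N :: nat and X Y :: real
  assumes d: "d \<ge> 2" and q: "\<And>i. i \<in> {1..d} \<Longrightarrow> q i \<ge> 2" and k: "k = (\<Prod>i\<in>{1..d}. q i)"
    and r: "1 \<le> r" "real r \<le> X" and N: "real N = X * Y" and Y: "Y = X ^ (d - 1)"
    and T: "\<And>i. i \<in> {1..d} \<Longrightarrow> X \<le> real (q i) ^ T i"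
      "\<And>i. i \<in> {1..d} \<Longrightarrow> real (q i) ^ T i \<le> real (q i) * X"
      "\<And>i t. i \<in> {1..d} \<Longrightarrow> t < T i \<Longrightarrow> real (q i) ^ t < X"
  shows "(real k + 1) * (\<Sum>i\<in>{1..d}. real N * real r / real (q i ^ T i) + real r + real (q i ^ T i))
      + 2 * real (\<Prod>i\<in>{1..d}. card {t. t < T i \<and> r < q i ^ Suc t} * ((q i)\<^sup>2 * r))
    \<le> ((real k + 1) * (real k * (real k + 2)) + 2 * real k ^ 2 * 2 ^ k) * (real r * (1 + ln (X / real r)) * Y)"
proof -
  define L where "L = ln (X / real r)"
  have X: "1 \<le> X" using r by linarith
  have L0: "0 \<le> L" using r unfolding L_def by simp
  \<comment> \<open>Here \<open>d \<ge> 2\<close> enters: it lets \<open>Y\<close> absorb the terms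
    \<open>q i ^ T i\<close>, which are of size \<open>X\<close>.\<close>
  have "X ^ 1 \<le> X ^ (d - 1)" using X d by (intro power_increasing) auto
  then have XY: "X \<le> Y" by (simp add: Y)
  have Y1: "1 \<le> Y" using X XY by linarith
  have qk: "q i \<le> k" if "i \<in> {1..d}" for i
    unfolding k using that q by (intro dvd_imp_le dvd_prodI prod_pos) force+
  \<comment> \<open>Bounding \<open>d\<close> by \<open>k\<close> makes the final constant depend on
    \<open>k\<close> alone.\<close>
  have "2 ^ d = (\<Prod>i\<in>{1..d}. 2::nat)" by simp
  also have "\<dots> \<le> k" unfolding k using q by (intro prod_mono) auto
  finally have "2 ^ d \<le> k" .
  then have dk: "d \<le> k" using less_exp[of d] by linarith
  have rL: "real r \<le> real r * (1 + L)" using L0 r by (simp add: algebra_simps)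
  have each: "real N * real r / real (q i ^ T i) + real r + real (q i ^ T i) \<le> (real k + 2) * (real r * (1 + L) * Y)"
    if i: "i \<in> {1..d}" for i
  proof -
    have "real N * real r / real (q i ^ T i) \<le> real N * real r / X"
      using T(1)[OF i] X q[OF i] by (intro divide_left_mono mult_pos_pos) auto
    also have "\<dots> = real r * Y" using X by (simp add: N)
    also have "\<dots> \<le> real r * (1 + L) * Y" using rL Y1 by (intro mult_right_mono) auto
    finally have 1: "real N * real r / real (q i ^ T i) \<le> real r * (1 + L) * Y" .
    have 2: "real r * 1 \<le> real r * (1 + L) * Y" using rL Y1 L0 by (intro mult_mono) auto
    have "real (q i ^ T i) \<le> real (q i) * X" using T(2)[OF i] by simp
    also have "\<dots> \<le> real k * Y" using qk[OF i] XY X by (intro mult_mono) auto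
    also have "\<dots> \<le> real k * (real r * (1 + L) * Y)"
    proof (intro mult_left_mono)
      have "1 \<le> real r * (1 + L)" using rL r(1) by linarith
      then show "Y \<le> real r * (1 + L) * Y" using Y1 by simp
    qed simp
    finally show ?thesis using 1 2 by (simp add: algebra_simps)
  qed
  have "(\<Sum>i\<in>{1..d}. real N * real r / real (q i ^ T i) + real r + real (q i ^ T i)) \<le>
      (\<Sum>i\<in>{1..d}. (real k + 2) * (real r * (1 + L) * Y))"
    by (rule sum_mono[OF each])
  also have "\<dots> = real d * ((real k + 2) * (real r * (1 + L) * Y))" by simp
  also have "\<dots> \<le> real k * ((real k + 2) * (real r * (1 + L) * Y))"
    using dk r L0 Y1 by (intro mult_right_mono) auto
  finally have S: "(\<Sum>i\<in>{1..d}. real N * real r / real (q i ^ T i) + real r + real (q i ^ T i)) \<le>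
      real k * (real k + 2) * (real r * (1 + L) * Y)" by (simp add: mult_ac)
  have "real (\<Prod>i\<in>{1..d}. card {t. t < T i \<and> r < q i ^ Suc t} * ((q i)\<^sup>2 * r)) =
      (\<Prod>i\<in>{1..d}. real (card {t. t < T i \<and> r < q i ^ Suc t}) * ((real (q i))\<^sup>2 * real r))"
    by simp
  also have "\<dots> \<le> (\<Prod>i\<in>{1..d}. 2 * (1 + L) * ((real (q i))\<^sup>2 * real r))"
  proof (rule prod_mono)
    fix i assume i: "i \<in> {1..d}"
    have "real (card {t. t < T i \<and> r < q i ^ Suc t}) \<le> 2 * (1 + L)"
      unfolding L_def by (rule card_levels_le) (use q r T(3) i in auto)
    then show "0 \<le> real (card {t. t < T i \<and> r < q i ^ Suc t}) * ((real (q i))\<^sup>2 * real r) \<and>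
        real (card {t. t < T i \<and> r < q i ^ Suc t}) * ((real (q i))\<^sup>2 * real r)
        \<le> 2 * (1 + L) * ((real (q i))\<^sup>2 * real r)"
      by (auto intro: mult_right_mono)
  qed
  also have "\<dots> = real k ^ 2 * 2 ^ d * (real r * (1 + L)) ^ d"
  proof -
    define b where "b = real r * (1 + L)"
    have "(\<Prod>i\<in>{1..d}. 2 * (1 + L) * ((real (q i))\<^sup>2 * real r)) = (\<Prod>i\<in>{1..d}. (real (q i))\<^sup>2 * (2 * b))"
      by (simp only: b_def mult_ac)
    also have "\<dots> = (\<Prod>i\<in>{1..d}. real (q i))\<^sup>2 * (2 * b) ^ d"
      by (simp add: prod.distrib prod_power_distrib)
    finally show ?thesis unfolding k b_def[symmetric] by (simp add: power_mult_distrib)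
  qed
  also have "\<dots> \<le> real k ^ 2 * 2 ^ k * (real r * (1 + L) * Y)"
  proof (intro mult_mono)
    have "exp L = X / real r" using r X by (simp add: L_def)
    then have "1 + L \<le> X / real r" by (metis exp_ge_add_one_self)
    then have "real r * (1 + L) \<le> X" using r by (simp add: field_simps)
    then have "(real r * (1 + L)) ^ (d - 1) \<le> X ^ (d - 1)" using L0 by (intro power_mono) auto
    then have "real r * (1 + L) * (real r * (1 + L)) ^ (d - 1) \<le> real r * (1 + L) * Y"
      unfolding Y using L0 by (intro mult_left_mono) auto
    then show "(real r * (1 + L)) ^ d \<le> real r * (1 + L) * Y"
      using d by (simp add: power_eq_if)
    show "(2::real) ^ d \<le> 2 ^ k" using dk by (intro power_increasing) auto
  qed (use L0 in auto)
  finally have P: "real (\<Prod>i\<in>{1..d}. card {t. t < T i \<and> r < q i ^ Suc t} * ((q i)\<^sup>2 * r)) \<le>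
      real k ^ 2 * 2 ^ k * (real r * (1 + L) * Y)" .
  let ?S = "\<Sum>i\<in>{1..d}. real N * real r / real (q i ^ T i) + real r + real (q i ^ T i)"
  let ?P = "real (\<Prod>i\<in>{1..d}. card {t. t < T i \<and> r < q i ^ Suc t} * ((q i)\<^sup>2 * r))"
  let ?W = "real r * (1 + L) * Y"
  have "(real k + 1) * ?S \<le> (real k + 1) * (real k * (real k + 2) * ?W)"
    by (intro mult_left_mono S) simp
  moreover have "2 * ?P \<le> 2 * (real k ^ 2 * 2 ^ k * ?W)"
    by (intro mult_left_mono P) simp
  ultimately have "(real k + 1) * ?S + 2 * ?P \<le>
      (real k + 1) * (real k * (real k + 2)) * ?W + 2 * real k ^ 2 * 2 ^ k * ?W"
    unfolding mult.assoc by (rule add_mono)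
  also have "\<dots> = ((real k + 1) * (real k * (real k + 2)) + 2 * real k ^ 2 * 2 ^ k) * ?W"
    by (rule distrib_right[symmetric])
  finally show ?thesis unfolding L_def .
qed

text \<open>The constant is chosen before all other data, so it depends only on \<open>k\<close>.
  The condition \<open>r2 - r1 \<le> N powr (1 / d)\<close> keeps the logarithm nonnegative; for
  fixed \<open>r1\<close> and \<open>r2\<close> it holds for all large \<open>N\<close>.\<close>

theorem theorem5:
  fixes k :: nat
  shows "\<exists>C>0. \<forall>(d::nat) (p::nat \<Rightarrow> nat) (ks::nat \<Rightarrow> nat)
           (M::nat \<Rightarrow> nat \<Rightarrow> nat \<Rightarrow> nat \<Rightarrow> int) (a::nat \<Rightarrow> nat \<Rightarrow> nat \<Rightarrow> int) (r1::nat) (r2::nat).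
      d \<ge> 2 \<longrightarrow>
      (\<forall>i\<in>{1..d}. prime (p i)) \<longrightarrow>
      inj_on p {1..d} \<longrightarrow>
      (\<forall>i\<in>{1..d}. ks i > 0) \<longrightarrow>
      k = (\<Prod>i\<in>{1..d}. p i ^ ks i) \<longrightarrow>
      (\<forall>i\<in>{1..d}. M i \<in> difference_matrices (p i ^ ks i) (p i ^ ks i) (Zp_power (p i) (ks i))) \<longrightarrow>
      (\<forall>i\<in>{1..d}. rudin_shapiro (p i) (ks i) (M i) (a i)) \<longrightarrow>
      r1 < r2 \<longrightarrow>
      (\<forall>N::nat. real r2 - real r1 \<le> real N powr (1 / real d) \<longrightarrow>
        \<bar>(\<Sum>n<N. discrepancy (combined_seq d a) (n + r1) (n + r2)) - real N * (1 - 1 / real k)\<bar>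
          \<le> C * (((real r2 - real r1) * ln (real N powr (1 / real d) / (real r2 - real r1)) + real r2)
                  * real N powr ((real d - 1) / real d)))"
proof -
  define C where "C = (real k + 1) * (real k * (real k + 2)) + 2 * real k ^ 2 * 2 ^ k"
  have C0: "C \<ge> 0" by (simp add: C_def)
  show ?thesis
  \<comment> \<open>Adding 1 gives strict positivity from \<open>C \<ge> 0\<close>.\<close>
  proof (rule exI[of _ "C + 1"], intro conjI allI impI)
    show "0 < C + 1" using C0 by simp
    fix d :: nat and p ks :: "nat \<Rightarrow> nat" and M :: "nat \<Rightarrow> nat \<Rightarrow> nat \<Rightarrow> nat \<Rightarrow> int"
      and a :: "nat \<Rightarrow> nat \<Rightarrow> nat \<Rightarrow> int" and r1 r2 N :: nat
    assume d: "d \<ge> 2" and p: "\<forall>i\<in>{1..d}. prime (p i)" and inj: "inj_on p {1..d}"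
      and ks: "\<forall>i\<in>{1..d}. ks i > 0" and k: "k = (\<Prod>i\<in>{1..d}. p i ^ ks i)"
      and M: "\<forall>i\<in>{1..d}. M i \<in> difference_matrices (p i ^ ks i) (p i ^ ks i) (Zp_power (p i) (ks i))"
      and a: "\<forall>i\<in>{1..d}. rudin_shapiro (p i) (ks i) (M i) (a i)"
      and r12: "r1 < r2" and rX: "real r2 - real r1 \<le> real N powr (1 / real d)"
    define r where "r = r2 - r1"
    define X where "X = real N powr (1 / real d)"
    define Y where "Y = real N powr ((real d - 1) / real d)"
    define q where "q i = p i ^ ks i" for i
    have r: "1 \<le> r" "real r2 - real r1 = real r" "real r \<le> X" "r2 = r1 + r"
      using r12 rX by (auto simp: r_def X_def)
    have X1: "1 \<le> X" using r by linarith
    \<comment> \<open>\<open>0 powr (1 / d)\<close> is \<open>0\<close>, which contradicts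
      \<open>1 \<le> X\<close>.\<close>
    then have "N \<noteq> 0" by (cases N) (auto simp: X_def)
    then have N1: "real N > 0" by simp
    have YX: "Y = X ^ (d - 1)"
      using N1 d by (simp add: X_def Y_def powr_powr powr_realpow[symmetric] of_nat_diff)
    have NXY: "real N = X * Y"
    proof -
      have "1 / real d + (real d - 1) / real d = 1" using d by (simp add: field_simps)
      then show ?thesis using N1 by (simp add: X_def Y_def powr_add[symmetric])
    qed
    have rs: "rs_system (Zp_power (p i) (ks i)) (q i) (M i) (a i)" if "i \<in> {1..d}" for i
      unfolding q_def using p ks M a that by (intro rudin_shapiro_rs_system) auto
    have q2: "q i \<ge> 2" if "i \<in> {1..d}" for i using rs_system.q_ge_2[OF rs[OF that]] .
    have cop: "coprime (q i) (q j)" if "i \<in> {1..d}" "j \<in> {1..d}" "i \<noteq> j" for i j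
    proof -
      have "p i \<noteq> p j" using inj that by (auto dest: inj_onD)
      then show ?thesis using p that by (simp add: q_def primes_coprime)
    qed
    have "\<forall>i\<in>{1..d}. \<exists>T. X \<le> real (q i) ^ T \<and> real (q i) ^ T \<le> real (q i) * X \<and> (\<forall>t<T. real (q i) ^ t < X)"
      using ex_level_bound[OF q2 X1] by blast
    then obtain T where T: "\<forall>i\<in>{1..d}. X \<le> real (q i) ^ T i \<and> real (q i) ^ T i \<le> real (q i) * X \<and>
        (\<forall>t<T i. real (q i) ^ t < X)"
      unfolding bchoice_iff by blast
    let ?Z = "card {n. n < N \<and> (\<forall>i\<in>{1..d}. a i (n + r2) = a i (n + r1))}"
    let ?W = "real r * (1 + ln (X / real r)) * Y"
    have kq: "k = (\<Prod>i\<in>{1..d}. q i)" by (simp add: k q_def)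
    have "\<bar>real k * real ?Z - real N\<bar> \<le>
        (real k + 1) * (\<Sum>i\<in>{1..d}. real N * real r / real (q i ^ T i) + real r + real (q i ^ T i))
        + 2 * real (\<Prod>i\<in>{1..d}. card {t. t < T i \<and> r < q i ^ Suc t} * ((q i)\<^sup>2 * r))"
      unfolding kq r(4) add.assoc[symmetric]
      by (rule count_coincidences[OF _ rs cop]) (use r(1) in auto)
    also have "\<dots> \<le> C * ?W"
      unfolding C_def using T by (intro error_terms_le[OF d q2 kq r(1,3) NXY YX]) blast+
    finally have main: "\<bar>real k * real ?Z - real N\<bar> \<le> C * ?W" .
    have "k > 0" unfolding kq using q2 by (intro prod_pos) force
    then have k1: "1 \<le> real k" by simp
    have L0: "0 \<le> ln (X / real r)" using r by simp
    have Y0: "0 \<le> Y" by (simp add: Y_def)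
    have W0: "0 \<le> ?W" using L0 Y0 by simp
    have "(\<Sum>n<N. discrepancy (combined_seq d a) (n + r1) (n + r2)) - real N * (1 - 1 / real k) =
        - ((real k * real ?Z - real N) / real k)"
      unfolding sum_discrepancy using k1 by (simp add: field_simps)
    then have "\<bar>(\<Sum>n<N. discrepancy (combined_seq d a) (n + r1) (n + r2)) - real N * (1 - 1 / real k)\<bar> =
        \<bar>real k * real ?Z - real N\<bar> / real k"
      by simp
    also have "\<dots> \<le> C * ?W / 1" using main k1 by (intro frac_le) auto
    also have "\<dots> \<le> (C + 1) * ((real r * ln (X / real r) + real r2) * Y)"
      unfolding div_by_1
    proof (rule mult_mono)
      \<comment> \<open>The summand \<open>r\<close> left over from
        \<open>r * (1 + ln (X / r))\<close> is at most \<open>r2 = r1 + r\<close>.\<close>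
      show "?W \<le> (real r * ln (X / real r) + real r2) * Y"
        using r(4) Y0 by (intro mult_right_mono) (simp_all add: algebra_simps)
    qed (use C0 W0 in auto)
    finally show "\<bar>(\<Sum>n<N. discrepancy (combined_seq d a) (n + r1) (n + r2)) - real N * (1 - 1 / real k)\<bar>
          \<le> (C + 1) * (((real r2 - real r1) * ln (real N powr (1 / real d) / (real r2 - real r1)) + real r2)
                  * real N powr ((real d - 1) / real d))"
      unfolding r(2) X_def Y_def .
  qed
qed

end
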